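(* Any complex nilpotent Leibniz algebra of dimension $n$ less than four is not rigid (in the variety $\mathcal{L}eib_n$).
   Context: All algebras are finite-dimensional over $\mathbb{C}$. A (right) Leibniz algebra is a vector space $L$ with a bilinear bracket satisfying $[x,[y,z]]=[[x,y],z]-[[x,z],y]$ for all $x,y,z\in L$. It is nilpotent if its lower central series $L^1=L$, $L^{k+1}=[L^k,L]$ reaches $0$. $\mathcal{L}eib_n$ is the variety of all $n$-dimensional Leibniz algebra structures on $V=\mathbb{C}^n$, viewed as an algebraic subset of $\mathrm{Hom}(V\otimes V,V)$ with the Zariski topology. $\mathrm{GL}_n(\mathbb{C})$ acts by $(g*\lambda)(x,y)=g(\lambda(g^{-1}x,g^{-1}y))$, and the orbits are the isomorphism classes. An algebra is rigid if its orbit is Zariski open in $\mathcal{L}eib_n$.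
   Formalization: The dimension n is taken to be 2 or 3: in dimensions 0 and 1 the only Leibniz algebra is the zero algebra, which is nilpotent and whose orbit is the whole variety, so it is rigid and the claim fails there. *)

theory Defs
  imports "HOL-Analysis.Analysis"
begin

section \<open>Leibniz algebra structures on complex n-space\<close>

type_synonym 'n bracket = "complex^'n \<Rightarrow> complex^'n \<Rightarrow> complex^'n"

text \<open>Elements of Hom(V \<otimes> V, V). The library constant \<^const>\<open>bilinear\<close> is only real-bilinear,
  so linearity is stated here for the complex scalar multiplication.\<close>

definition cbilinear :: "('n::finite) bracket \<Rightarrow> bool" where
  "cbilinear \<mu> \<longleftrightarrow>
     (\<forall>x. Vector_Spaces.linear (*s) (*s) (\<lambda>y. \<mu> x y)) \<and>
     (\<forall>y. Vector_Spaces.linear (*s) (*s) (\<lambda>x. \<mu> x y))"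

definition leibniz_algebra :: "('n::finite) bracket \<Rightarrow> bool" where
  "leibniz_algebra \<mu> \<longleftrightarrow>
     cbilinear \<mu> \<and> (\<forall>x y z. \<mu> x (\<mu> y z) = \<mu> (\<mu> x y) z - \<mu> (\<mu> x z) y)"

definition Leib :: "('n::finite) bracket set" where
  "Leib = {\<mu>. leibniz_algebra \<mu>}"

text \<open>The index is shifted by one: \<open>lower_central \<mu> k\<close> is the term \<open>L^(k+1)\<close>. The product of two
  subspaces is the span of all brackets.\<close>

primrec lower_central :: "('n::finite) bracket \<Rightarrow> nat \<Rightarrow> (complex^'n) set" where
  "lower_central \<mu> 0 = UNIV"
| "lower_central \<mu> (Suc k) = vec.span {\<mu> x y | x y. x \<in> lower_central \<mu> k}"

definition nilpotent_algebra :: "('n::finite) bracket \<Rightarrow> bool" where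
  "nilpotent_algebra \<mu> \<longleftrightarrow> (\<exists>k. lower_central \<mu> k = {0})"

section \<open>The Zariski topology\<close>

text \<open>Polynomial functions in the structure constants of a bracket.\<close>

inductive_set poly_fun :: "(('n::finite) bracket \<Rightarrow> complex) set" where
  const: "(\<lambda>\<mu>. c) \<in> poly_fun"
| coord: "(\<lambda>\<mu>. \<mu> (axis i 1) (axis j 1) $ k) \<in> poly_fun"
| add: "p \<in> poly_fun \<Longrightarrow> q \<in> poly_fun \<Longrightarrow> (\<lambda>\<mu>. p \<mu> + q \<mu>) \<in> poly_fun"
| mult: "p \<in> poly_fun \<Longrightarrow> q \<in> poly_fun \<Longrightarrow> (\<lambda>\<mu>. p \<mu> * q \<mu>) \<in> poly_fun"

definition zero_locus :: "(('n::finite) bracket \<Rightarrow> complex) set \<Rightarrow> 'n bracket set" where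
  "zero_locus P = {\<mu>. cbilinear \<mu> \<and> (\<forall>p\<in>P. p \<mu> = 0)}"

definition zariski_open :: "('n::finite) bracket set \<Rightarrow> bool" where
  "zariski_open U \<longleftrightarrow> (\<exists>P\<subseteq>poly_fun. U = {\<mu>. cbilinear \<mu>} - zero_locus P)"

definition zariski :: "('n::finite) bracket topology" where
  "zariski = topology zariski_open"

lemma istopology_zariski_open: "istopology (zariski_open :: ('n::finite) bracket set \<Rightarrow> bool)"
  unfolding istopology_def
proof (intro conjI allI impI)
  fix S T :: "'n bracket set"
  assume S: "zariski_open S" and T: "zariski_open T"
  obtain P where P: "P \<subseteq> poly_fun" "S = {\<mu>. cbilinear \<mu>} - zero_locus P"
    using S[unfolded zariski_open_def] by (elim exE conjE)
  obtain Q where Q: "Q \<subseteq> poly_fun" "T = {\<mu>. cbilinear \<mu>} - zero_locus Q"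
    using T[unfolded zariski_open_def] by (elim exE conjE)
  define R where "R = (\<lambda>(p, q) (\<mu> :: 'n bracket). p \<mu> * q \<mu> :: complex) ` (P \<times> Q)"
  have "zero_locus R = zero_locus P \<union> zero_locus Q"
    by (fastforce simp: zero_locus_def R_def)
  then have "S \<inter> T = {\<mu>. cbilinear \<mu>} - zero_locus R"
    using P(2) Q(2) by blast
  moreover have "R \<subseteq> poly_fun"
    using P(1) Q(1) by (auto simp: R_def intro!: poly_fun.mult)
  ultimately show "zariski_open (S \<inter> T)"
    unfolding zariski_open_def by (intro exI[of _ R] conjI)
next
  fix K :: "'n bracket set set"
  assume "\<forall>S\<in>K. zariski_open S"
  then have "\<forall>S\<in>K. \<exists>P. P \<subseteq> poly_fun \<and> S = {\<mu>. cbilinear \<mu>} - zero_locus P"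
    unfolding zariski_open_def .
  then obtain P where P: "\<forall>S\<in>K. P S \<subseteq> poly_fun \<and> S = {\<mu>. cbilinear \<mu>} - zero_locus (P S)"
    by (rule bchoice[THEN exE])
  define R where "R = (\<Union>S\<in>K. P S)"
  have "{\<mu>. cbilinear \<mu>} - zero_locus R = (\<Union>S\<in>K. {\<mu>. cbilinear \<mu>} - zero_locus (P S))"
    by (auto simp: zero_locus_def R_def)
  also have "\<dots> = (\<Union>S\<in>K. S)"
    using P by (intro SUP_cong) simp_all
  finally have "\<Union>K = {\<mu>. cbilinear \<mu>} - zero_locus R"
    by simp
  moreover have "R \<subseteq> poly_fun"
    using P unfolding R_def by blast
  ultimately show "zariski_open (\<Union>K)"
    unfolding zariski_open_def by (intro exI[of _ R] conjI)
qed

lemma openin_zariski: "openin zariski U \<longleftrightarrow> zariski_open U"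
  by (simp add: zariski_def istopology_zariski_open)

section \<open>The action of the general linear group, and rigidity\<close>

definition gl_act :: "complex^'n^'n \<Rightarrow> ('n::finite) bracket \<Rightarrow> 'n bracket" where
  "gl_act g \<mu> = (\<lambda>x y. g *v \<mu> (matrix_inv g *v x) (matrix_inv g *v y))"

definition gl_orbit :: "('n::finite) bracket \<Rightarrow> 'n bracket set" where
  "gl_orbit \<mu> = {gl_act g \<mu> | g. invertible g}"

definition rigid :: "('n::finite) bracket \<Rightarrow> bool" where
  "rigid \<mu> \<longleftrightarrow> \<mu> \<in> Leib \<and> openin (subtopology zariski Leib) (gl_orbit \<mu>)"

text \<open>In dimension one, the variety consists of the zero bracket alone, which is nilpotent and whose
  orbit is therefore open. Non-rigidity of nilpotent algebras can thus only be claimed from dimension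
  two on.\<close>

lemma leibniz_dim_one:
  fixes \<mu> :: "('n::finite) bracket"
  assumes n: "CARD('n) = 1" and L: "leibniz_algebra \<mu>"
  shows "\<mu> = (\<lambda>x y. 0)"
proof -
  obtain i :: 'n where U: "UNIV = {i}"
    using n card_1_singletonE by blast
  then have i: "j = i" for j :: 'n
    by (metis UNIV_I singletonD)
  define e :: "complex^'n" where "e = axis i 1"
  have ex: "x = x $ i *s e" for x :: "complex^'n"
    unfolding vec_eq_iff
  proof
    show "x $ j = (x $ i *s e) $ j" for j
      by (simp add: e_def axis_def i[of j])
  qed
  have r: "\<mu> x (c *s y) = c *s \<mu> x y" and l: "\<mu> (c *s x) y = c *s \<mu> x y" for c x y
    using L by (auto simp: leibniz_algebra_def cbilinear_def Vector_Spaces.linear_iff)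
  define c where "c = \<mu> e e $ i"
  have ee: "\<mu> e e = c *s e"
    unfolding c_def by (rule ex)
  have "\<mu> e (\<mu> e e) = 0"
    using L by (simp add: leibniz_algebra_def)
  then have "(c * c) *s e = 0"
    by (simp add: ee r)
  moreover have "e \<noteq> 0"
    by (simp add: e_def axis_eq_0_iff)
  ultimately have "c = 0"
    by simp
  then have 0: "\<mu> e e = 0"
    using ee by simp
  have "\<mu> x y = 0" for x y
  proof -
    have "\<mu> (x $ i *s e) (y $ i *s e) = 0"
      by (simp add: r l 0)
    then show ?thesis
      by (simp flip: ex)
  qed
  then show ?thesis
    by (intro ext)
qed

lemma rigid_dim_one:
  fixes \<mu> :: "('n::finite) bracket"
  assumes n: "CARD('n) = 1" and L: "leibniz_algebra \<mu>"
  shows "nilpotent_algebra \<mu> \<and> rigid \<mu>"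
proof
  have \<mu>: "\<mu> = (\<lambda>x y. 0)"
    using leibniz_dim_one[OF n L] .
  have "lower_central \<mu> 1 = {0}"
    by (auto simp: \<mu> vec.span_breakdown_eq)
  then show "nilpotent_algebra \<mu>"
    unfolding nilpotent_algebra_def by blast
  have Leib: "(Leib :: 'n bracket set) = {\<mu>}"
  proof (rule set_eqI)
    fix \<nu> :: "'n bracket"
    have "leibniz_algebra \<nu> \<Longrightarrow> \<nu> = \<mu>"
      unfolding \<mu> by (rule leibniz_dim_one[OF n])
    then show "\<nu> \<in> Leib \<longleftrightarrow> \<nu> \<in> {\<mu>}"
      using L unfolding Leib_def by blast
  qed
  have inv: "invertible (mat 1 :: complex^'n^'n)"
    unfolding invertible_def by (metis matrix_mul_lid)
  have "gl_orbit \<mu> = {\<mu>}"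
    unfolding gl_orbit_def gl_act_def \<mu> using inv by auto
  moreover have "openin zariski {\<mu>. cbilinear (\<mu> :: 'n bracket)}"
  proof -
    have "{\<mu>. cbilinear \<mu>} = {\<mu>. cbilinear \<mu>} - zero_locus {\<lambda>\<mu> :: 'n bracket. 1}"
      by (auto simp: zero_locus_def)
    then show ?thesis
      unfolding openin_zariski zariski_open_def
      by (intro exI[of _ "{\<lambda>\<mu>. 1}"] conjI) (auto intro: poly_fun.const)
  qed
  moreover have "{\<mu>} = {\<mu>. cbilinear (\<mu> :: 'n bracket)} \<inter> Leib"
    using L unfolding Leib leibniz_algebra_def by blast
  ultimately show "rigid \<mu>"
    unfolding rigid_def openin_subtopology using L Leib by blast
qed

end

theory Submission
  imports Defs
begin

text \<open>
  Every nilpotent Leibniz algebra \<open>\<mu>\<close> of dimension two or three is the value at \<open>t = 0\<close> of a family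
  \<open>\<mu> + t \<delta>\<close> of Leibniz algebras that are not nilpotent for \<open>t \<noteq> 0\<close>. A polynomial that separates \<open>\<mu>\<close>
  from the complement of its orbit is continuous in \<open>t\<close>, so an open orbit would contain members
  of the family with small \<open>t \<noteq> 0\<close>; but all algebras in the orbit are nilpotent
  (\<open>not_rigid_if_line\<close>). Non-nilpotency is always witnessed by a nonzero \<open>u\<close> with \<open>[u, y] = c u\<close> and
  \<open>c \<noteq> 0\<close>, which survives in the whole lower central series.

  Two families suffice. If \<open>[x, y] = f(y) R(x)\<close> with a nonzero functional \<open>f\<close> and \<open>f \<circ> R = 0\<close>, then
  \<open>R\<close> may be replaced by any other map into the kernel of \<open>f\<close>, in particular by \<open>R + t P\<close> where \<open>P\<close>
  projects onto that kernel (\<open>not_rigid_if_rank_one\<close>). If \<open>[x, y] = B(x, y) e\<^sub>3\<close> with \<open>e\<^sub>3\<close> central in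
  dimension three, the bilinear form that \<open>B\<close> induces modulo \<open>e\<^sub>3\<close> has an isotropic vector \<open>e\<^sub>2\<close>
  because the field is algebraically closed; \<open>e\<^sub>2\<close> and \<open>e\<^sub>3\<close> then span an abelian ideal, on which
  left and right multiplication by \<open>e\<^sub>1\<close> can be deformed together (\<open>not_rigid_if_isotropic\<close>,
  \<open>not_rigid_if_class_two\<close>).

  These cases are exhaustive without any classification. Nilpotency gives a basis in which each
  vector is central modulo the span of those after it (\<open>nilpotent_central_mod_subspace\<close>). For a basis
  \<open>v, u\<close> of this kind in dimension two, only \<open>[v, v]\<close> can be nonzero, which is the first case. For a
  basis \<open>w, v, u\<close> in dimension three, write \<open>[w, w] = p v + a u\<close>. If \<open>p = 0\<close>, all brackets are multiples
  of \<open>u\<close>, the second case. If \<open>p \<noteq> 0\<close>, then \<open>v\<close> is right annihilating, because squares are, and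
  only right multiplication by \<open>w\<close> remains, the first case.
\<close>

section \<open>Degenerating families obstruct rigidity\<close>

lemma cbilinear_iff:
  "cbilinear \<mu> \<longleftrightarrow>
     (\<forall>x y z. \<mu> x (y + z) = \<mu> x y + \<mu> x z \<and> \<mu> (x + y) z = \<mu> x z + \<mu> y z) \<and>
     (\<forall>c x y. \<mu> x (c *s y) = c *s \<mu> x y \<and> \<mu> (c *s x) y = c *s \<mu> x y)"
  unfolding cbilinear_def Vector_Spaces.linear_iff using vec.vector_space_axioms by blast

lemma leibniz_bilinear:
  assumes "leibniz_algebra \<mu>"
  shows "\<mu> (x + y) z = \<mu> x z + \<mu> y z" and "\<mu> (c *s x) y = c *s \<mu> x y"
    and "\<mu> x (y + z) = \<mu> x y + \<mu> x z" and "\<mu> x (c *s y) = c *s \<mu> x y"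
  using assms by (simp_all add: leibniz_algebra_def cbilinear_iff)

lemma cbilinear_zero:
  assumes "cbilinear \<mu>"
  shows "\<mu> x 0 = 0"
  using assms unfolding cbilinear_iff by (metis vec.scale_zero_left)

lemma subspace_lower_central: "vec.subspace (lower_central \<mu> k)"
  by (cases k) (simp_all add: vec.subspace_UNIV)

text \<open>An eigenvector of a right multiplication with nonzero eigenvalue obstructs nilpotency.\<close>

lemma eigenvector_in_lower_central:
  assumes "\<mu> u y = c *s u" and "c \<noteq> 0"
  shows "u \<in> lower_central \<mu> k"
proof (induction k)
  case (Suc k)
  have "c *s u \<in> lower_central \<mu> (Suc k)"
    using Suc assms(1) by (metis (mono_tags, lifting) lower_central.simps(2) mem_Collect_eq vec.span_base)
  then have "inverse c *s (c *s u) \<in> lower_central \<mu> (Suc k)"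
    by (rule vec.subspace_scale[OF subspace_lower_central])
  then show ?case
    using assms(2) by (simp add: vector_smult_assoc)
qed simp

lemma nilpotent_no_eigenvector:
  assumes "nilpotent_algebra \<mu>" and "\<mu> u y = c *s u" and "c \<noteq> 0"
  shows "u = 0"
  using assms eigenvector_in_lower_central unfolding nilpotent_algebra_def by blast

lemma matrix_inv_inverse:
  fixes A :: "'a::semiring_1^'n^'m"
  assumes "invertible A"
  shows "A ** matrix_inv A = mat 1" and "matrix_inv A ** A = mat 1"
  using assms someI_ex[of "\<lambda>B. A ** B = mat 1 \<and> B ** A = mat 1"]
  unfolding invertible_def matrix_inv_def by auto

text \<open>An eigenvector in an isomorphic algebra pulls back along the isomorphism to one in \<open>\<mu>\<close>, so the lower
  central series itself need not be transported.\<close>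

lemma gl_orbit_no_eigenvector:
  assumes nil: "nilpotent_algebra \<mu>" and orbit: "\<nu> \<in> gl_orbit \<mu>"
    and eig: "\<nu> u y = c *s u" "c \<noteq> 0"
  shows "u = 0"
proof -
  obtain g where g: "invertible g" "\<nu> = gl_act g \<mu>"
    using orbit unfolding gl_orbit_def by blast
  let ?h = "matrix_inv g"
  have hg: "?h *v (g *v x) = x" and gh: "g *v (?h *v x) = x" for x
    using g(1) by (simp_all add: matrix_vector_mul_assoc matrix_inv_inverse)
  have "?h *v (\<nu> u y) = \<mu> (?h *v u) (?h *v y)"
    by (simp add: g(2) gl_act_def hg)
  then have "\<mu> (?h *v u) (?h *v y) = c *s (?h *v u)"
    by (simp add: eig(1) vector_scalar_commute)
  then have "?h *v u = 0"
    using nilpotent_no_eigenvector[OF nil] eig(2) by blast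
  then show ?thesis
    using gh[of u] by simp
qed

lemma self_in_gl_orbit:
  fixes \<mu> :: "('n::finite) bracket"
  shows "\<mu> \<in> gl_orbit \<mu>"
proof -
  have "invertible (mat 1 :: complex^'n^'n)"
    unfolding invertible_def by (metis matrix_mul_lid)
  moreover from this have "matrix_inv (mat 1 :: complex^'n^'n) = mat 1"
    by (metis matrix_inv_inverse(1) matrix_mul_lid)
  ultimately have "invertible (mat 1 :: complex^'n^'n)" and "gl_act (mat 1) \<mu> = \<mu>"
    by (simp_all only: gl_act_def matrix_vector_mul_lid)
  then show ?thesis
    unfolding gl_orbit_def by force
qed

lemma poly_fun_continuous_on_line:
  assumes "p \<in> poly_fun"
  shows "isCont (\<lambda>t. p (\<lambda>x y. \<mu> x y + t *s \<delta> x y)) s"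
  using assms by induction (auto intro!: continuous_intros)

text \<open>If the orbit is open, some polynomial that does not vanish at \<open>\<mu>\<close> vanishes at every Leibniz algebra
  outside the orbit. By continuity it does not vanish on the line near \<open>t = 0\<close> either, which forces
  nilpotency for some \<open>t \<noteq> 0\<close>.\<close>

lemma not_rigid_if_line:
  assumes nil: "nilpotent_algebra \<mu>"
    and leib: "\<And>t. leibniz_algebra (\<lambda>x y. \<mu> x y + t *s \<delta> x y)"
    and eig: "\<And>t. t \<noteq> 0 \<Longrightarrow> \<exists>u y c. \<mu> u y + t *s \<delta> u y = c *s u \<and> c \<noteq> 0 \<and> u \<noteq> 0"
  shows "\<not> rigid \<mu>"
proof
  assume rigid: "rigid \<mu>"
  define \<nu> where "\<nu> t = (\<lambda>x y. \<mu> x y + t *s \<delta> x y)" for t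
  have \<nu>0: "\<nu> 0 = \<mu>"
    by (simp add: \<nu>_def)
  obtain P where P: "P \<subseteq> poly_fun" "gl_orbit \<mu> = ({\<mu>. cbilinear \<mu>} - zero_locus P) \<inter> Leib"
    using rigid unfolding rigid_def openin_subtopology openin_zariski zariski_open_def by blast
  have \<nu>: "\<nu> t \<in> Leib" "cbilinear (\<nu> t)" for t
    using leib[of t] by (auto simp: \<nu>_def Leib_def leibniz_algebra_def)
  have "\<mu> \<notin> zero_locus P" "cbilinear \<mu>"
    using self_in_gl_orbit[of \<mu>] P(2) by auto
  then obtain p where p: "p \<in> P" "p \<mu> \<noteq> 0"
    by (auto simp: zero_locus_def)
  have "isCont (\<lambda>t. p (\<nu> t)) 0"
    using poly_fun_continuous_on_line p(1) P(1) unfolding \<nu>_def by blast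
  then have "((\<lambda>t. p (\<nu> t)) \<longlongrightarrow> p \<mu>) (at 0)"
    by (simp add: isCont_def \<nu>0)
  then have "\<forall>\<^sub>F t in at 0. p (\<nu> t) \<noteq> 0"
    using p(2) by (rule tendsto_imp_eventually_ne)
  moreover have "\<forall>\<^sub>F t in at (0::complex). t \<noteq> 0"
    by (rule eventually_neq_at_within)
  ultimately have "\<forall>\<^sub>F t in at 0. p (\<nu> t) \<noteq> 0 \<and> t \<noteq> 0"
    by (rule eventually_conj)
  then obtain t where t: "p (\<nu> t) \<noteq> 0" "t \<noteq> 0"
    using eventually_happens'[OF at_neq_bot] by blast
  have "\<nu> t \<in> gl_orbit \<mu>"
    using \<nu>[of t] t(1) p(1) unfolding P(2) zero_locus_def by blast
  then show False
    using eig[OF t(2)] gl_orbit_no_eigenvector[OF nil] unfolding \<nu>_def by blast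
qed

section \<open>Deformations of nilpotent algebras\<close>

definition functional :: "(complex^'n \<Rightarrow> complex) \<Rightarrow> bool" where
  "functional f \<longleftrightarrow> Vector_Spaces.linear (*s) (*) f"

lemma functional_iff:
  "functional f \<longleftrightarrow> (\<forall>x y. f (x + y) = f x + f y) \<and> (\<forall>c x. f (c *s x) = c * f x)"
proof -
  have "vector_space ((*) :: complex \<Rightarrow> _)"
    by unfold_locales (simp_all add: algebra_simps)
  then show ?thesis
    unfolding functional_def Vector_Spaces.linear_iff using vec.vector_space_axioms by blast
qed

lemma functional_zero: "functional f \<Longrightarrow> f 0 = 0"
  by (metis functional_iff mult_zero_left vec.scale_zero_left)

lemma functional_diff: "functional f \<Longrightarrow> f (x - y) = f x - f y"
  by (metis functional_iff add_diff_cancel diff_add_cancel)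

text \<open>The right multiplications span at most the line of \<open>R = \<mu> _ e\<close>. Any \<open>R\<close> with image in the kernel
  of \<open>f\<close> gives a Leibniz algebra \<open>f(y) R(x)\<close>: then \<open>[y, z]\<close> is right annihilating, and
  \<open>[[x, y], z] = f(y) f(z) R(R(x))\<close> is symmetric in \<open>y\<close> and \<open>z\<close>. Adding \<open>t\<close> times the projection onto
  the kernel turns the null vector \<open>u\<close> of \<open>R\<close> into an eigenvector for \<open>t\<close>.\<close>

lemma not_rigid_if_rank_one:
  assumes leib: "leibniz_algebra \<mu>" and nil: "nilpotent_algebra \<mu>"
    and f: "functional f" "f e = 1"
    and rank_one: "\<And>x y. \<mu> x y = f y *s \<mu> x e"
    and u: "u \<noteq> 0" "f u = 0" "\<mu> u e = 0"
  shows "\<not> rigid \<mu>"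
proof (rule not_rigid_if_line[OF nil])
  note bil = leibniz_bilinear[OF leib]
  have fl: "f (x + y) = f x + f y" "f (c *s x) = c * f x" "f (x - y) = f x - f y" for c x y
    using f(1) by (simp_all add: functional_iff functional_diff)
  \<comment> \<open>The Leibniz identity for \<open>y, x, e\<close> reads \<open>f(R x) R y = 0\<close>.\<close>
  have f0: "f (\<mu> x e) = 0" for x
  proof (cases "\<forall>y. \<mu> y e = 0")
    case True
    then show ?thesis by (simp add: functional_zero[OF f(1)])
  next
    case False
    then obtain y where y: "\<mu> y e \<noteq> 0" by blast
    have "f (\<mu> x e) *s \<mu> y e = \<mu> y (\<mu> x e)"
      by (rule rank_one[symmetric])
    also have "\<dots> = \<mu> (\<mu> y x) e - \<mu> (\<mu> y e) x"
      using leib by (simp add: leibniz_algebra_def)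
    also have "\<dots> = 0"
      by (simp add: rank_one[of y x] rank_one[of "\<mu> y e" x] bil)
    finally show ?thesis
      using y by simp
  qed
  define R where "R t x = \<mu> x e + t *s (x - f x *s e)" for t x
  have eq: "(\<lambda>x y. \<mu> x y + t *s (f y *s (x - f x *s e))) = (\<lambda>x y. f y *s R t x)" for t
  proof (intro ext)
    show "\<mu> x y + t *s (f y *s (x - f x *s e)) = f y *s R t x" for x y
      by (subst rank_one) (simp add: R_def vec.scale_right_distrib ac_simps)
  qed
  have fR: "f (R t x) = 0" for t x
    by (simp add: R_def fl f0 f(2))
  have R: "R t (x + y) = R t x + R t y" "R t (c *s x) = c *s R t x" for t c x y
    by (simp_all add: R_def fl bil vec_eq_iff algebra_simps)
  show "leibniz_algebra (\<lambda>x y. \<mu> x y + t *s (f y *s (x - f x *s e)))" for t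
    unfolding eq leibniz_algebra_def cbilinear_iff
    by (simp add: fR R fl vec_eq_iff algebra_simps)
  fix t :: complex
  assume "t \<noteq> 0"
  moreover have "\<mu> u e + t *s (f e *s (u - f u *s e)) = t *s u"
    by (simp add: u f(2))
  ultimately show "\<exists>u y c. \<mu> u y + t *s (f y *s (u - f u *s e)) = c *s u \<and> c \<noteq> 0 \<and> u \<noteq> 0"
    using u(1) by blast
qed

text \<open>
  Consider the algebras with abelian ideal \<open>h\<close> spanned by \<open>e\<^sub>2, e\<^sub>3\<close>. Let \<open>S\<close> and \<open>D\<close> be left and right
  multiplication by \<open>e\<^sub>1\<close> on \<open>h\<close>. The Leibniz identity then says \<open>S D = D S\<close>, \<open>S (S + D) = 0\<close> and
  \<open>S [e\<^sub>1, e\<^sub>1] = 0\<close>. Here \<open>S e\<^sub>2 = b e\<^sub>3\<close> and \<open>D e\<^sub>2 = c e\<^sub>3\<close>. These equations are still satisfied by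
  \<open>S e\<^sub>2 = t b e\<^sub>2 + b e\<^sub>3\<close>, \<open>S e\<^sub>3 = 0\<close>, \<open>D e\<^sub>2 = - t b e\<^sub>2 + c e\<^sub>3\<close>, \<open>D e\<^sub>3 = - t (b + c) e\<^sub>3\<close>, and
  \<open>t e\<^sub>2 + e\<^sub>3\<close> is an eigenvector of \<open>D\<close> for \<open>- t b\<close>. For \<open>b = 0\<close> this eigenvalue vanishes, but then
  \<open>h\<close> is right annihilating and the rank-one deformation applies.
\<close>

lemma not_rigid_if_isotropic:
  fixes e1 e2 e3 :: "complex^'n::finite"
  assumes leib: "leibniz_algebra \<mu>" and nil: "nilpotent_algebra \<mu>"
    and f: "functional f1" "functional f2" "functional f3"
    and coords: "\<And>x. x = f1 x *s e1 + f2 x *s e2 + f3 x *s e3"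
    and dual: "f1 e1 = 1" "f1 e2 = 0" "f1 e3 = 0" "f2 e1 = 0" "f2 e2 = 1" "f2 e3 = 0"
      "f3 e1 = 0" "f3 e2 = 0" "f3 e3 = 1"
    and mult: "\<mu> e1 e1 = a *s e3" "\<mu> e1 e2 = b *s e3" "\<mu> e2 e1 = c *s e3" "\<mu> e2 e2 = 0"
    and central: "\<And>x. \<mu> x e3 = 0" "\<And>x. \<mu> e3 x = 0"
  shows "\<not> rigid \<mu>"
proof -
  note bil = leibniz_bilinear[OF leib]
  have fl: "f1 (x + y) = f1 x + f1 y" "f1 (c *s x) = c * f1 x"
      "f2 (x + y) = f2 x + f2 y" "f2 (c *s x) = c * f2 x"
      "f3 (x + y) = f3 x + f3 y" "f3 (c *s x) = c * f3 x" for c x y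
    using f by (simp_all add: functional_iff)
  have e3: "e3 \<noteq> 0"
    using dual(9) functional_zero[OF f(3)] by auto
  have \<mu>: "\<mu> x y = (a * f1 x * f1 y + b * f1 x * f2 y + c * f2 x * f1 y) *s e3" for x y
  proof -
    have "\<mu> x y = \<mu> (f1 x *s e1 + f2 x *s e2 + f3 x *s e3) (f1 y *s e1 + f2 y *s e2 + f3 y *s e3)"
      by (simp only: coords[symmetric])
    also have "\<dots> = (a * f1 x * f1 y + b * f1 x * f2 y + c * f2 x * f1 y) *s e3"
      by (simp add: bil mult central) (simp add: vec_eq_iff algebra_simps)
    finally show ?thesis .
  qed
  show ?thesis
  proof (cases "b = 0")
    case True
    have "\<mu> x y = f1 y *s \<mu> x e1" for x y
      by (simp add: \<mu> True dual) (simp add: algebra_simps)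
    then show ?thesis
      using not_rigid_if_rank_one[OF leib nil f(1) dual(1) _ e3 dual(3) central(2)] by blast
  next
    case False
    \<comment> \<open>The coefficients of \<open>e\<^sub>2\<close> and \<open>e\<^sub>3\<close> in the deformed bracket.\<close>
    define P where "P t x y = t * b * (f1 x * f2 y - f2 x * f1 y)" for t x y
    define Q where "Q t x y = a * f1 x * f1 y + b * f1 x * f2 y + c * f2 x * f1 y - t * (b + c) * f3 x * f1 y"
      for t x y
    define \<delta> where
      "\<delta> x y = (b * (f1 x * f2 y - f2 x * f1 y)) *s e2 - ((b + c) * f3 x * f1 y) *s e3" for x y
    have \<nu>: "\<mu> x y + t *s \<delta> x y = P t x y *s e2 + Q t x y *s e3" for t x y
      by (simp add: \<mu> \<delta>_def P_def Q_def vec_eq_iff algebra_simps)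
    have lin: "P t (x + y) z = P t x z + P t y z" "P t x (y + z) = P t x y + P t x z"
        "Q t (x + y) z = Q t x z + Q t y z" "Q t x (y + z) = Q t x y + Q t x z"
        "P t (k *s x) z = k * P t x z" "P t x (k *s z) = k * P t x z"
        "Q t (k *s x) z = k * Q t x z" "Q t x (k *s z) = k * Q t x z" for t k x y z
      by (simp_all add: P_def Q_def fl algebra_simps)
    have PQ: "P t x e2 = t * b * f1 x" "P t x e3 = 0" "P t e2 x = - t * b * f1 x" "P t e3 x = 0"
        "Q t x e2 = b * f1 x" "Q t x e3 = 0" "Q t e2 x = c * f1 x" "Q t e3 x = - t * (b + c) * f1 x"
      for t x
      by (simp_all add: P_def Q_def dual)
    show ?thesis
    proof (rule not_rigid_if_line[OF nil])
      show "leibniz_algebra (\<lambda>x y. \<mu> x y + t *s \<delta> x y)" for t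
        unfolding \<nu> leibniz_algebra_def cbilinear_iff
        by (simp add: lin PQ vec_eq_iff) (simp add: P_def Q_def algebra_simps)
    next
      fix t :: complex
      assume t: "t \<noteq> 0"
      let ?w = "t *s e2 + e3"
      have "\<mu> ?w e1 + t *s \<delta> ?w e1 = (- t * b) *s ?w"
        unfolding \<nu> by (simp add: P_def Q_def fl dual vec_eq_iff algebra_simps)
      moreover have "?w \<noteq> 0"
      proof
        assume "?w = 0"
        then have "f3 ?w = 0" using functional_zero[OF f(3)] by simp
        then show False by (simp add: fl dual)
      qed
      ultimately show "\<exists>u y c. \<mu> u y + t *s \<delta> u y = c *s u \<and> c \<noteq> 0 \<and> u \<noteq> 0"
        using t False by (metis mult_eq_0_iff neg_equal_0_iff_equal)
    qed
  qed
qed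

lemma complex_quadratic_root:
  fixes a b d :: complex
  assumes "d \<noteq> 0"
  shows "\<exists>s. a + b * s + d * s^2 = 0"
proof
  let ?r = "csqrt (b^2 - 4 * a * d)"
  have r: "?r^2 = b^2 - 4 * a * d" by simp
  have "a + b * ((?r - b) / (2 * d)) + d * ((?r - b) / (2 * d))^2 =
      (?r^2 - (b^2 - 4 * a * d)) / (4 * d)"
    using assms by (simp add: field_simps power2_eq_square del: power2_csqrt)
  then show "a + b * ((?r - b) / (2 * d)) + d * ((?r - b) / (2 * d))^2 = 0"
    unfolding r by simp
qed

text \<open>If \<open>e\<^sub>2\<close> is not isotropic, some \<open>e\<^sub>1 + s e\<^sub>2\<close> is, since isotropy is a quadratic equation for \<open>s\<close>;
  this vector takes the place of \<open>e\<^sub>2\<close>, and \<open>e\<^sub>2\<close> that of \<open>e\<^sub>1\<close>.\<close>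

lemma not_rigid_if_class_two:
  fixes e1 e2 e3 :: "complex^'n::finite"
  assumes leib: "leibniz_algebra \<mu>" and nil: "nilpotent_algebra \<mu>"
    and f: "functional f1" "functional f2" "functional f3"
    and coords: "\<And>x. x = f1 x *s e1 + f2 x *s e2 + f3 x *s e3"
    and dual: "f1 e1 = 1" "f1 e2 = 0" "f1 e3 = 0" "f2 e1 = 0" "f2 e2 = 1" "f2 e3 = 0"
      "f3 e1 = 0" "f3 e2 = 0" "f3 e3 = 1"
    and mult: "\<mu> e1 e1 = a *s e3" "\<mu> e1 e2 = b *s e3" "\<mu> e2 e1 = c *s e3" "\<mu> e2 e2 = d *s e3"
    and central: "\<And>x. \<mu> x e3 = 0" "\<And>x. \<mu> e3 x = 0"
  shows "\<not> rigid \<mu>"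
proof (cases "d = 0")
  case True
  then have "\<mu> e2 e2 = 0" by (simp add: mult)
  then show ?thesis
    using not_rigid_if_isotropic[OF leib nil f coords dual mult(1-3) _ central] by blast
next
  case False
  note bil = leibniz_bilinear[OF leib]
  have fl: "f1 (x + y) = f1 x + f1 y" "f1 (c *s x) = c * f1 x"
      "f2 (x + y) = f2 x + f2 y" "f2 (c *s x) = c * f2 x"
      "f3 (x + y) = f3 x + f3 y" "f3 (c *s x) = c * f3 x" for c x y
    using f by (simp_all add: functional_iff)
  obtain s where s: "a + (b + c) * s + d * s^2 = 0"
    using complex_quadratic_root[OF False] by blast
  let ?q = "e1 + s *s e2"
  have qq: "\<mu> ?q ?q = 0"
  proof -
    have "\<mu> ?q ?q = (a + (b + c) * s + d * s^2) *s e3"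
      by (simp add: bil mult vec_eq_iff algebra_simps power2_eq_square)
    then show ?thesis by (simp add: s)
  qed
  have g: "functional (\<lambda>x. f2 x - s * f1 x)"
    by (simp add: functional_iff fl algebra_simps)
  show ?thesis
  proof (rule not_rigid_if_isotropic[OF leib nil g f(1) f(3), where ?e1.0 = e2 and ?e2.0 = ?q and ?e3.0 = e3])
    show "x = (f2 x - s * f1 x) *s e2 + f1 x *s ?q + f3 x *s e3" for x
      by (subst coords[of x]) (simp add: vec_eq_iff algebra_simps)
    show "\<mu> e2 e2 = d *s e3" "\<mu> e2 ?q = (c + s * d) *s e3" "\<mu> ?q e2 = (b + s * d) *s e3"
      by (simp_all add: bil mult vec_eq_iff algebra_simps)
  qed (simp_all add: fl dual qq central)
qed

section \<open>A flag basis of a nilpotent algebra\<close>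

text \<open>The lower central series is defined by brackets from the right, but the Leibniz identity
  \<open>[x, [a, b]] = [[x, a], b] - [[x, b], a]\<close> makes it a series of two-sided ideals. The second term
  needs the induction hypothesis with \<open>[x, b]\<close>, one step further down, in place of \<open>x\<close>; hence the
  general \<open>i\<close>. The sum of the indices is shifted because \<open>lower_central \<mu> k\<close> is \<open>L^(k+1)\<close>.\<close>

lemma lower_central_mult:
  assumes leib: "leibniz_algebra \<mu>"
    and "x \<in> lower_central \<mu> i" and "y \<in> lower_central \<mu> j"
  shows "\<mu> x y \<in> lower_central \<mu> (Suc (i + j))"
  using assms(2,3)
proof (induction j arbitrary: i x y)
  case 0
  then show ?case by (auto intro: vec.span_base)
next
  case (Suc j)
  note bil = leibniz_bilinear[OF leib]
  let ?S = "lower_central \<mu> (Suc (i + Suc j))"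
  have sub: "vec.subspace ?S"
    by (rule subspace_lower_central)
  have "y \<in> vec.span {\<mu> a b | a b. a \<in> lower_central \<mu> j}"
    using Suc.prems(2) by simp
  then show ?case
  proof (induction rule: vec.span_induct_alt)
    case base
    show ?case
      using leib vec.subspace_0[OF sub] by (simp add: leibniz_algebra_def cbilinear_zero)
  next
    case (step c w y)
    then obtain a b where w: "w = \<mu> a b" "a \<in> lower_central \<mu> j" by blast
    have "\<mu> x a \<in> lower_central \<mu> (Suc (i + j))"
      using Suc.IH Suc.prems(1) w(2) by blast
    then have "\<mu> (\<mu> x a) b \<in> ?S"
      by (auto intro!: vec.span_base)
    moreover have "\<mu> x b \<in> lower_central \<mu> (Suc i)"
      using Suc.prems(1) by (auto intro!: vec.span_base)
    then have "\<mu> (\<mu> x b) a \<in> ?S"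
      using Suc.IH[of "\<mu> x b" "Suc i" a] w(2) by simp
    moreover have "\<mu> x w = \<mu> (\<mu> x a) b - \<mu> (\<mu> x b) a"
      using leib by (simp add: leibniz_algebra_def w(1))
    ultimately have "\<mu> x w \<in> ?S"
      using vec.subspace_diff[OF sub] by simp
    then show ?case
      unfolding bil using step.IH vec.subspace_add[OF sub] vec.subspace_scale[OF sub] by blast
  qed
qed

text \<open>Take \<open>z\<close> outside \<open>W\<close> in the last term of the lower central series that is not contained in \<open>W\<close>.
  Iterating this with the span of the vectors found so far yields a basis.\<close>

lemma nilpotent_central_mod_subspace:
  assumes leib: "leibniz_algebra \<mu>" and nil: "nilpotent_algebra \<mu>"
    and W: "vec.subspace W" "W \<noteq> UNIV"
  obtains z where "z \<notin> W" and "\<And>x. \<mu> z x \<in> W" and "\<And>x. \<mu> x z \<in> W"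
proof -
  obtain k where "lower_central \<mu> k = {0}"
    using nil by (auto simp: nilpotent_algebra_def)
  then have k: "lower_central \<mu> k \<subseteq> W"
    using vec.subspace_0[OF W(1)] by simp
  define m where "m = (LEAST k. lower_central \<mu> k \<subseteq> W)"
  have m: "lower_central \<mu> m \<subseteq> W"
    unfolding m_def using k by (rule LeastI)
  then have "m \<noteq> 0"
    using W(2) by (auto intro: Nat.gr0I)
  then obtain j where j: "m = Suc j"
    using not0_implies_Suc by blast
  have "\<not> lower_central \<mu> j \<subseteq> W"
    using not_less_Least[of j "\<lambda>k. lower_central \<mu> k \<subseteq> W"] j by (simp add: m_def)
  then obtain z where z: "z \<in> lower_central \<mu> j" "z \<notin> W" by blast
  have "\<mu> z x \<in> W" "\<mu> x z \<in> W" for x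
    using lower_central_mult[OF leib z(1), of x 0] lower_central_mult[OF leib _ z(1), of x 0] m j
    by auto
  with z(2) show thesis by (rule that)
qed

lemma span_neq_UNIV:
  fixes S :: "(complex^'n::finite) set"
  assumes "finite S" "card S < CARD('n)"
  shows "vec.span S \<noteq> UNIV"
proof
  assume "vec.span S = UNIV"
  then have "CARD('n) \<le> card S"
    using vec.dim_le_card[of UNIV S] assms(1) by (simp add: card_cart_basis)
  then show False
    using assms(2) by simp
qed

lemma independent_span_UNIV:
  fixes B :: "(complex^'n::finite) set"
  assumes "vec.independent B" "card B = CARD('n)"
  shows "vec.span B = UNIV"
  using vec.card_ge_dim_independent[of B UNIV] assms by (auto simp: card_cart_basis)

lemma functional_representation:
  fixes B :: "(complex^'n::finite) set"
  assumes "vec.independent B" "vec.span B = UNIV"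
  shows "functional (\<lambda>x. vec.representation B x b)"
  using assms by (simp add: functional_iff vec.representation_add vec.representation_scale)

theorem theorem3p13:
  fixes \<mu> :: "('n::finite) bracket"
  assumes "2 \<le> CARD('n)"
    and "CARD('n) < 4"
    and "leibniz_algebra \<mu>"
    and "nilpotent_algebra \<mu>"
  shows "\<not> rigid \<mu>"
proof -
  note leib = assms(3) and nil = assms(4)
  note bil = leibniz_bilinear[OF leib]
  have "vec.span {} \<noteq> (UNIV :: (complex^'n) set)"
    by (rule span_neq_UNIV) simp_all
  then obtain u where u: "u \<noteq> 0" "\<And>x. \<mu> u x = 0" "\<And>x. \<mu> x u = 0"
    using nilpotent_central_mod_subspace[OF leib nil vec.subspace_span, of "{}"] by auto
  have "vec.span {u} \<noteq> UNIV"
    using assms(1) by (intro span_neq_UNIV) simp_all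
  then obtain v where v: "v \<notin> vec.span {u}" "\<And>x. \<mu> v x \<in> vec.span {u}" "\<And>x. \<mu> x v \<in> vec.span {u}"
    using nilpotent_central_mod_subspace[OF leib nil vec.subspace_span] by blast
  have ind2: "vec.independent {v, u}"
    using u(1) v(1) by (simp add: vec.independent_insert)
  have vu: "v \<noteq> u"
    using v(1) vec.span_base by blast
  show ?thesis
  proof (cases "CARD('n) = 2")
    case True
    let ?f = "\<lambda>x. vec.representation {v, u} x"
    have sp: "vec.span {v, u} = UNIV"
      using ind2 vu True by (intro independent_span_UNIV) simp_all
    have coords: "x = ?f x v *s v + ?f x u *s u" for x
      using vec.sum_representation_eq[OF ind2, of x "{v, u}"] vu by (simp add: sp)
    have "\<mu> x y = ?f y v *s \<mu> x v" for x y
    proof -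
      have "\<mu> x y = \<mu> x (?f y v *s v + ?f y u *s u)"
        by (simp only: coords[symmetric])
      then show ?thesis
        by (simp only: bil u vec.scale_zero_right add_0_right)
    qed
    moreover have "?f v v = 1" "?f u v = 0"
      using ind2 vu by (simp_all add: vec.representation_basis)
    ultimately show ?thesis
      using not_rigid_if_rank_one[OF leib nil functional_representation[OF ind2 sp] _ _ u(1) _ u(2)]
      by blast
  next
    case False
    then have n: "CARD('n) = 3"
      using assms(1,2) by linarith
    have "vec.span {v, u} \<noteq> UNIV"
      using vu n by (intro span_neq_UNIV) simp_all
    then obtain w where w: "w \<notin> vec.span {v, u}" "\<And>x. \<mu> w x \<in> vec.span {v, u}"
        "\<And>x. \<mu> x w \<in> vec.span {v, u}"
      using nilpotent_central_mod_subspace[OF leib nil vec.subspace_span] by blast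
    have wuv: "w \<noteq> u" "w \<noteq> v"
      using w(1) vec.span_base by blast+
    have ind3: "vec.independent {w, v, u}"
      using vec.independent_insertI[OF w(1) ind2] .
    have sp: "vec.span {w, v, u} = UNIV"
      using ind3 vu wuv n by (intro independent_span_UNIV) simp_all
    let ?f = "\<lambda>b x. vec.representation {w, v, u} x b"
    note f = functional_representation[OF ind3 sp]
    have coords: "x = ?f w x *s w + ?f v x *s v + ?f u x *s u" for x
      using vec.sum_representation_eq[OF ind3, of x "{w, v, u}"] vu wuv by (simp add: sp add.assoc)
    have dual: "?f w w = 1" "?f w v = 0" "?f w u = 0" "?f v w = 0" "?f v v = 1" "?f v u = 0"
      "?f u w = 0" "?f u v = 0" "?f u u = 1"
      using ind3 vu wuv by (auto simp: vec.representation_basis)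
    obtain p where "\<mu> w w - p *s v \<in> vec.span {u}"
      using w(2)[of w] by (auto simp: vec.span_breakdown_eq[of _ v])
    then obtain a where "\<mu> w w - p *s v = a *s u"
      unfolding vec.span_singleton by blast
    then have a: "\<mu> w w = p *s v + a *s u"
      by (simp add: diff_eq_eq add.commute)
    obtain b c d where bcd: "\<mu> w v = b *s u" "\<mu> v w = c *s u" "\<mu> v v = d *s u"
      using v(2)[of w] v(2)[of v] v(3)[of w] unfolding vec.span_singleton by blast
    show ?thesis
    proof (cases "p = 0")
      case True
      then have "\<mu> w w = a *s u" by (simp add: a)
      then show ?thesis
        using not_rigid_if_class_two[OF leib nil f f f coords dual _ bcd u(3) u(2)] by blast
    next
      case False
      \<comment> \<open>Squares are right annihilating, hence so is \<open>v\<close>, which is a combination of \<open>[w, w]\<close> and \<open>u\<close>.\<close>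
      have xv: "\<mu> x v = 0" for x
      proof -
        have "\<mu> x (\<mu> w w) = 0"
          using leib by (simp add: leibniz_algebra_def)
        then show ?thesis
          using False by (simp add: a bil u)
      qed
      have "\<mu> x y = ?f w y *s \<mu> x w" for x y
      proof -
        have "\<mu> x y = \<mu> x (?f w y *s w + ?f v y *s v + ?f u y *s u)"
          by (simp only: coords[symmetric])
        then show ?thesis
          by (simp only: bil u xv vec.scale_zero_right add_0_right)
      qed
      then show ?thesis
        using not_rigid_if_rank_one[OF leib nil f dual(1) _ u(1) dual(3) u(2)] by blast
    qed
  qed
qed

end
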